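(* For all integers $m\ge 0$ and $n\le m$, $$B_{2n}^{(2m+2)}(m+1)=\frac{(2n)!}{(2m)!}\sum_{j=2m-2n}^{2m}\frac{1}{j+1}\,s(2m,j)\,(j+2n-2m+1)_{2m-2n+1}\, B_{j+2n-2m}(m),$$ $$B_{2n}^{(2m+1)}(m)=\frac{(2n)!}{(2m-1)!}\sum_{j=2m-1-2n}^{2m-1}\frac{1}{j+1}\,s(2m-1,j)\,(j+2n-2m+2)_{2m-2n}\, B_{j+2n-2m+1}(m).$$
   Context: $s(n,k)$ are the (signed) Stirling numbers of the first kind: $x(x-1)\cdots(x-n+1)=\sum_{k=0}^n s(n,k)x^k$. $(a)_r=\Gamma(a+r)/\Gamma(a)=a(a+1)\cdots(a+r-1)$ is the Pochhammer symbol, with $(a)_0=1$. The Bernoulli polynomials $B_n(t)$ are defined by $\frac{x e^{tx}}{e^x-1}=\sum_{n=0}^\infty\frac{B_n(t)}{n!}x^n$, and for an integer $r$ and real $t$ the generalized Bernoulli polynomials $B_n^{(r)}(t)$ by $\frac{x^r}{(e^x-1)^r}e^{tx}=\sum_{n=0}^\infty \frac{B_n^{(r)}(t)}{n!}x^n$, both for $|x|<2\pi$.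
   Formalization: The second identity is stated only for n < m: for n = m its sum starts at j = -1, where the term 1/(j+1) is undefined, and reading that term as 0 makes the identity false (m = n = 1 gives 0 on the left and 1/6 on the right). *)

theory Defs
  imports
    "HOL-Complex_Analysis.Complex_Analysis"
    "HOL-Computational_Algebra.Computational_Algebra"
    "HOL-Combinatorics.Stirling"
begin

text \<open>
  Signed Stirling numbers of the first kind, as the coefficients of the falling factorial
  $x (x-1) \cdots (x-n+1)$. The library's \<open>stirling\<close> is the unsigned version.
\<close>
definition signed_stirling :: "nat \<Rightarrow> nat \<Rightarrow> int" where
  "signed_stirling n k = poly.coeff (\<Prod>i<n. [:- int i, 1:]) k"

text \<open>
  The generating functions are formal power series: \<open>fps_X / (fps_exp 1 - 1)\<close> is the unit
  $x / (e^x - 1)$ with constant term 1, so that integer powers of either sign make sense.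
  Lemmas \<open>bernpoly_sums\<close> and \<open>gen_bernpoly_sums\<close> below give the corresponding
  convergent expansions for real $x$ with $0 < |x| < 2\pi$.
\<close>
definition bernpoly :: "nat \<Rightarrow> real \<Rightarrow> real" where
  "bernpoly n t = fact n * fps_nth (fps_X * fps_exp t / (fps_exp 1 - 1)) n"

definition gen_bernpoly_fps :: "int \<Rightarrow> 'a :: field_char_0 \<Rightarrow> 'a fps" where
  "gen_bernpoly_fps r t = (fps_X / (fps_exp 1 - 1)) powi r * fps_exp t"

definition gen_bernpoly :: "int \<Rightarrow> nat \<Rightarrow> real \<Rightarrow> real" where
  "gen_bernpoly r n t = fact n * fps_nth (gen_bernpoly_fps r t) n"


lemma falling_factorial_eq_signed_stirling:
  fixes x :: "'a :: comm_ring_1"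
  shows "(\<Prod>i<n. x - of_nat i) = (\<Sum>k\<le>n. of_int (signed_stirling n k) * x ^ k)"
proof (induction n)
  case 0
  show ?case by (simp add: signed_stirling_def)
next
  case (Suc n)
  define c where "c = (\<lambda>n k. of_int (signed_stirling n k) :: 'a)"
  have deg: "signed_stirling n (Suc n) = 0"
  proof -
    have "degree (\<Prod>i<n. [:- int i, 1:]) \<le> (\<Sum>i<n. degree [:- int i, 1:])"
      using degree_prod_sum_le[of "{..<n}" "\<lambda>i. [:- int i, 1:]"] by (simp add: o_def)
    also have "\<dots> = n" by simp
    finally show ?thesis unfolding signed_stirling_def by (intro coeff_eq_0) simp
  qed
  have c0: "c (Suc n) 0 = - of_nat n * c n 0"
    by (simp add: c_def signed_stirling_def)
  have cS: "c (Suc n) (Suc k) = c n k - of_nat n * c n (Suc k)" for k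
    by (simp add: c_def signed_stirling_def)
  have "(\<Prod>i<Suc n. x - of_nat i) = (\<Sum>k\<le>n. c n k * x ^ k) * (x - of_nat n)"
    using Suc.IH by (simp add: c_def)
  also have "\<dots> = (\<Sum>k\<le>n. c n k * x ^ Suc k) - of_nat n * (\<Sum>k\<le>Suc n. c n k * x ^ k)"
    by (simp add: c_def deg algebra_simps sum_distrib_left sum_distrib_right flip: sum.distrib)
  also have "\<dots> = (\<Sum>k\<le>Suc n. c (Suc n) k * x ^ k)"
    unfolding sum.atMost_Suc_shift[of _ n] c0 cS
    by (simp add: left_diff_distrib sum_subtractf distrib_left sum_distrib_left mult.assoc)
  finally show ?case by (simp add: c_def)
qed

lemma fps_X_over_exp_mult:
  "fps_X / (fps_exp 1 - 1) * (fps_exp 1 - 1 :: 'a :: field_char_0 fps) = fps_X"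
proof -
  have "subdegree (fps_exp 1 - 1 :: 'a fps) = 1"
    by (intro subdegreeI) auto
  moreover have "(fps_exp 1 - 1 :: 'a fps) \<noteq> 0"
    using calculation by force
  ultimately have "(fps_exp 1 - 1 :: 'a fps) dvd fps_X"
    by (simp add: fps_dvd_iff)
  thus ?thesis by simp
qed

lemma fps_X_over_exp_nth_0: "fps_nth (fps_X / (fps_exp 1 - 1) :: 'a :: field_char_0 fps) 0 = 1"
proof -
  have "fps_nth (fps_X / (fps_exp 1 - 1) * (fps_exp 1 - 1 :: 'a fps)) 1 = 1"
    unfolding fps_X_over_exp_mult by simp
  thus ?thesis by (simp add: fps_mult_nth)
qed

lemma bernpoly_eq_gen_bernpoly: "bernpoly n t = gen_bernpoly 1 n t"
proof -
  define E :: "real fps" where "E = fps_exp 1 - 1"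
  have E: "E \<noteq> 0"
    using fps_X_over_exp_mult[where ?'a = real] unfolding E_def by force
  have "fps_X * fps_exp t / E = (fps_X / E * fps_exp t) * E / E"
    using fps_X_over_exp_mult[where ?'a = real] unfolding E_def by (simp add: mult_ac)
  also have "\<dots> = fps_X / E * fps_exp t"
    using E by simp
  finally show ?thesis
    by (simp add: bernpoly_def gen_bernpoly_def gen_bernpoly_fps_def E_def)
qed

lemma gen_bernpoly_sums_complex:
  fixes z t :: complex
  assumes "z \<noteq> 0" "norm z < 2 * pi"
  shows "(\<lambda>n. fps_nth (gen_bernpoly_fps r t) n * z ^ n) sums
           ((z / (exp z - 1)) powi r * exp (t * z))"
proof -
  define q where "q = (\<lambda>z::complex. if z = 0 then 1 else z / (exp z - 1))"
  define Q :: "complex fps" where "Q = fps_X / (fps_exp 1 - 1)"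
  have Q0: "fps_nth Q 0 = 1"
    unfolding Q_def by (rule fps_X_over_exp_nth_0)
  have sub: "subdegree (fps_exp 1 - 1 :: complex fps) = 1"
    by (intro subdegreeI) auto
  have nz: "(fps_exp 1 - 1 :: complex fps) \<noteq> 0"
    using sub by force
  have "(\<lambda>z. exp z - 1 :: complex) has_fps_expansion (fps_exp 1 - 1)"
    by (intro fps_expansion_intros)
  hence q: "q has_fps_expansion Q"
    unfolding q_def Q_def by (intro has_fps_expansion_divide fps_expansion_intros) (use sub nz in auto)
  have exp_ne: "exp w \<noteq> 1" if "w \<noteq> 0" "norm w < 2 * pi" for w :: complex
  proof
    assume "exp w = 1"
    then obtain k :: int where k: "Re w = 0" "Im w = of_int (2 * k) * pi"
      unfolding exp_eq_1 by auto
    have "norm w = \<bar>Im w\<bar>" using k by (simp add: cmod_def)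
    hence "\<bar>of_int k\<bar> * (2 * pi) < 1 * (2 * pi)" using that k by (simp add: abs_mult)
    hence "\<bar>real_of_int k\<bar> < 1" by (simp add: mult_less_cancel_right)
    hence "k = 0" by linarith
    thus False using k that by (simp add: complex_eq_iff)
  qed
  have q_hol: "q holomorphic_on eball 0 (2 * pi)"
  proof -
    have ne: "q holomorphic_on (eball 0 (2 * pi) - {0})"
    proof -
      have "(\<lambda>z. z / (exp z - 1)) holomorphic_on (eball 0 (2 * pi) - {0})"
        using exp_ne by (intro holomorphic_intros) (auto simp: eball_def)
      thus ?thesis by (rule holomorphic_transform) (auto simp: q_def)
    qed
    have "q analytic_on {0}"
      using q by (rule has_fps_expansion_imp_analytic_0)
    hence "q analytic_on ((eball 0 (2 * pi) - {0}) \<union> {0})"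
      using ne by (subst analytic_on_Un) (auto simp: analytic_on_open open_eball open_delete)
    hence "q analytic_on eball 0 (2 * pi)"
      by (rule analytic_on_subset) auto
    thus ?thesis by (rule analytic_imp_holomorphic)
  qed
  have q_ne: "q w \<noteq> 0" if "w \<in> eball 0 (2 * pi)" for w
    using exp_ne[of w] that by (auto simp: q_def eball_def)
  have "(\<lambda>w. q w powi r) has_fps_expansion Q powi r"
    unfolding power_int_def using q Q0 by (auto intro!: fps_expansion_intros)
  hence "(\<lambda>w. q w powi r * exp (t * w)) has_fps_expansion gen_bernpoly_fps r t"
    unfolding gen_bernpoly_fps_def Q_def[symmetric] by (intro fps_expansion_intros)
  moreover have "(\<lambda>w. q w powi r * exp (t * w)) holomorphic_on eball 0 (2 * pi)"
    using q_hol q_ne by (intro holomorphic_intros) auto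
  ultimately have "(\<lambda>n. fps_nth (gen_bernpoly_fps r t) n * z ^ n) sums (q z powi r * exp (t * z))"
    by (rule has_fps_expansion_imp_sums_complex) (use assms in auto)
  thus ?thesis using assms by (simp add: q_def)
qed

lemma gen_bernpoly_fps_of_real:
  "fps_nth (gen_bernpoly_fps r (of_real t) :: complex fps) n =
     of_real (fps_nth (gen_bernpoly_fps r t) n)"
proof -
  define h :: "real fps \<Rightarrow> complex fps" where "h = (\<lambda>F. Abs_fps (\<lambda>n. of_real (fps_nth F n)))"
  have h_nth: "fps_nth (h F) n = of_real (fps_nth F n)" for F n
    by (simp add: h_def)
  have h_mult: "h (F * G) = h F * h G" for F G
    by (rule fps_ext) (simp add: h_nth fps_mult_nth)
  have h_1: "h 1 = 1" and h_X: "h fps_X = fps_X"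
    by (rule fps_ext, simp add: h_nth fps_X_def)+
  have h_power: "h (F ^ k) = h F ^ k" for F k
    by (induction k) (simp_all add: h_1 h_mult)
  have h_exp: "h (fps_exp c) = fps_exp (of_real c)" for c
    by (rule fps_ext) (simp add: h_nth)
  have h_E: "h (fps_exp 1 - 1) = fps_exp 1 - 1"
    by (rule fps_ext) (simp add: h_nth)
  define Q :: "real fps" where "Q = fps_X / (fps_exp 1 - 1)"
  define Q' :: "complex fps" where "Q' = fps_X / (fps_exp 1 - 1)"
  have Q0: "fps_nth Q 0 = 1" "fps_nth Q' 0 = 1"
    unfolding Q_def Q'_def by (rule fps_X_over_exp_nth_0)+
  have "h Q * (fps_exp 1 - 1) = Q' * (fps_exp 1 - 1)"
    unfolding Q'_def fps_X_over_exp_mult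
    unfolding h_E[symmetric] h_mult[symmetric] Q_def fps_X_over_exp_mult by (rule h_X)
  moreover have "(fps_exp 1 - 1 :: complex fps) \<noteq> 0"
    using fps_X_over_exp_mult[where ?'a = complex] by force
  ultimately have hQ: "h Q = Q'" by simp
  have "h (inverse Q) * Q' = 1"
    using Q0 unfolding hQ[symmetric] h_mult[symmetric] by (simp add: inverse_mult_eq_1 h_1)
  hence hQ': "h (inverse Q) = inverse Q'"
    by (metis fps_inverse_unique mult.commute)
  have "h (Q powi r) = Q' powi r"
    by (simp add: power_int_def h_power hQ hQ')
  hence "h (gen_bernpoly_fps r t) = gen_bernpoly_fps r (of_real t)"
    by (simp add: gen_bernpoly_fps_def h_mult h_exp Q_def Q'_def)
  thus ?thesis by (metis h_nth)
qed

theorem gen_bernpoly_sums: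
  fixes x t :: real
  assumes "x \<noteq> 0" "\<bar>x\<bar> < 2 * pi"
  shows "(\<lambda>n. gen_bernpoly r n t / fact n * x ^ n) sums ((x / (exp x - 1)) powi r * exp (t * x))"
proof -
  have "(\<lambda>n. complex_of_real (gen_bernpoly r n t / fact n * x ^ n)) sums
          complex_of_real ((x / (exp x - 1)) powi r * exp (t * x))"
    using gen_bernpoly_sums_complex[of "of_real x" r "of_real t"] assms
    by (simp add: gen_bernpoly_def gen_bernpoly_fps_of_real of_real_power_int flip: exp_of_real)
  thus ?thesis by (simp only: sums_of_real_iff)
qed

theorem bernpoly_sums:
  fixes x t :: real
  assumes "x \<noteq> 0" "\<bar>x\<bar> < 2 * pi"
  shows "(\<lambda>n. bernpoly n t / fact n * x ^ n) sums (x * exp (t * x) / (exp x - 1))"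
  using gen_bernpoly_sums[OF assms, of 1 t] by (simp add: bernpoly_eq_gen_bernpoly)

end

theory Submission
  imports Defs
begin

text \<open>
  Write \<open>Q\<close> for the power series \<open>x / (e\<^sup>x - 1)\<close> and \<open>[x\<^sup>i]\<close> for the extraction of a
  coefficient. Everything rests on one expression for the Stirling numbers:
  \<open>j! s(N, j) = N! [x\<^sup>N\<^sup>-\<^sup>j] e\<^sup>x Q\<^sup>N\<^sup>+\<^sup>1\<close>
  (lemma \<open>signed_stirling_conv_nth_bern_series_power\<close>). It is what remains of Cauchy's formula
  after the substitution \<open>w = e\<^sup>x - 1\<close>: the Stirling numbers satisfy
  \<open>j! s(N, j) = N! [w\<^sup>N] log (1 + w)\<^sup>j\<close>, and writing that coefficient as a residue
  turns \<open>log (1 + w)\<^sup>j w\<^sup>-\<^sup>N\<^sup>-\<^sup>1 dw\<close> into \<open>x\<^sup>j (e\<^sup>x - 1)\<^sup>-\<^sup>N\<^sup>-\<^sup>1 e\<^sup>x dx\<close>.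
  The proof below needs no residues; it checks instead that the right-hand side obeys the
  Stirling recurrence, using \<open>e\<^sup>x Q = Q + x\<close> and \<open>x Q' = Q - e\<^sup>x Q\<^sup>2\<close>.

  The generating function of the polynomials of order \<open>N + 2\<close> at \<open>t + 1\<close> factors as
  \<open>Q\<^sup>N\<^sup>+\<^sup>2 e\<^sup>(\<^sup>t\<^sup>+\<^sup>1\<^sup>)\<^sup>x = (e\<^sup>x Q\<^sup>N\<^sup>+\<^sup>1) (Q e\<^sup>t\<^sup>x)\<close>.
  The first factor carries the Stirling numbers and the second the Bernoulli polynomials at \<open>t\<close>,
  so comparing coefficients gives a single identity, \<open>gen_bernpoly_conv_signed_stirling\<close>, valid
  for every real \<open>t\<close> and every index \<open>\<le> N\<close>. Taking \<open>t = m\<close>, the first formula is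
  \<open>N = 2 m\<close>. For \<open>N = 2 m - 1\<close> the identity evaluates the polynomial of order \<open>2 m + 1\<close>
  at \<open>m + 1\<close>; the reflection \<open>t \<mapsto> 2 m + 1 - t\<close>, under which polynomials of even index are
  invariant, moves this to the point \<open>m\<close> of the second formula.
\<close>

section \<open>The series \<open>x / (e\<^sup>x - 1)\<close> and its powers\<close>

abbreviation bern_series :: "'a :: field_char_0 fps" where
  "bern_series \<equiv> fps_X / (fps_exp 1 - 1)"

lemma exp_minus_1_fps_nonzero: "fps_exp 1 - 1 \<noteq> (0 :: 'a :: field_char_0 fps)"
  using fps_X_over_exp_mult[where ?'a = 'a] by force

lemma exp_mult_bern_series: "fps_exp 1 * bern_series = bern_series + (fps_X :: 'a :: field_char_0 fps)"
  using fps_X_over_exp_mult[where ?'a = 'a] by (simp add: algebra_simps)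

text \<open>Differentiating \<open>Q (e\<^sup>x - 1) = x\<close> gives \<open>Q e\<^sup>x + Q' (e\<^sup>x - 1) = 1\<close>; multiply by \<open>Q\<close>.\<close>

lemma bern_series_deriv:
  "fps_X * fps_deriv bern_series = bern_series - fps_exp 1 * (bern_series :: 'a :: field_char_0 fps) ^ 2"
proof -
  define Q :: "'a fps" where "Q = bern_series"
  have Q: "Q * (fps_exp 1 - 1) = fps_X"
    unfolding Q_def by (rule fps_X_over_exp_mult)
  have "fps_deriv (Q * (fps_exp 1 - 1)) = 1"
    unfolding Q by simp
  hence "Q * fps_exp 1 + fps_deriv Q * (fps_exp 1 - 1) = 1"
    by simp
  hence "Q * (Q * fps_exp 1) + fps_deriv Q * (Q * (fps_exp 1 - 1)) = Q"
    by algebra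
  thus ?thesis
    unfolding Q by (simp add: Q_def [symmetric] power2_eq_square algebra_simps)
qed

text \<open>
  By the previous lemma, \<open>x (Q\<^sup>N\<^sup>+\<^sup>1)' = (N + 1) (Q\<^sup>N\<^sup>+\<^sup>1 - e\<^sup>x Q\<^sup>N\<^sup>+\<^sup>2)\<close>, and \<open>x d/dx\<close> multiplies the
  \<open>i\<close>-th coefficient by \<open>i\<close>. In terms of residues this is integration by parts.
\<close>

lemma nth_exp_mult_bern_series_power:
  "of_nat (Suc N) * fps_nth (fps_exp 1 * bern_series ^ (N + 2)) i =
     (of_nat (Suc N) - of_nat i) * fps_nth (bern_series ^ Suc N :: 'a :: field_char_0 fps) i"
proof -
  define Q :: "'a fps" where "Q = bern_series"
  have "fps_X * fps_deriv (Q ^ Suc N) = of_nat (Suc N) * (Q ^ N * (fps_X * fps_deriv Q))"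
    by (simp add: fps_deriv_power' mult_ac del: power_Suc of_nat_Suc)
  also have "\<dots> = of_nat (Suc N) * (Q ^ Suc N - fps_exp 1 * Q ^ (N + 2))"
    unfolding bern_series_deriv [where ?'a = 'a, folded Q_def]
    by (simp add: algebra_simps power2_eq_square)
  finally have "fps_nth (fps_X * fps_deriv (Q ^ Suc N)) i =
      fps_nth (of_nat (Suc N) * (Q ^ Suc N - fps_exp 1 * Q ^ (N + 2))) i"
    by simp
  moreover have "fps_nth (fps_X * fps_deriv (Q ^ Suc N)) i = of_nat i * fps_nth (Q ^ Suc N) i"
    by (cases i) (simp_all del: power_Suc)
  ultimately have "of_nat i * fps_nth (Q ^ Suc N) i =
      of_nat (Suc N) * (fps_nth (Q ^ Suc N) i - fps_nth (fps_exp 1 * Q ^ (N + 2)) i)"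
    by (simp only: fps_mult_of_nat_nth fps_sub_nth)
  thus ?thesis
    unfolding Q_def [symmetric] by (simp only: algebra_simps)
qed

section \<open>Stirling numbers as coefficients of \<open>e\<^sup>x (x / (e\<^sup>x - 1))\<^sup>N\<^sup>+\<^sup>1\<close>\<close>

lemma signed_stirling_Suc_0: "signed_stirling (Suc n) 0 = - int n * signed_stirling n 0"
  by (simp add: signed_stirling_def)

lemma signed_stirling_Suc_Suc:
  "signed_stirling (Suc n) (Suc k) = signed_stirling n k - int n * signed_stirling n (Suc k)"
  by (simp add: signed_stirling_def)

lemma signed_stirling_eq_0: "n < k \<Longrightarrow> signed_stirling n k = 0"
proof (induction n arbitrary: k)
  case 0
  thus ?case by (simp add: signed_stirling_def)
next
  case (Suc n)
  thus ?case by (cases k) (simp_all add: signed_stirling_Suc_Suc)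
qed

text \<open>
  Put \<open>c N i = [x\<^sup>i] e\<^sup>x Q\<^sup>N\<^sup>+\<^sup>1\<close> and \<open>b N i = [x\<^sup>i] Q\<^sup>N\<close>. For \<open>j = k + 1\<close> the Stirling recurrence
  becomes \<open>(N + 1) c (N + 1) (N - k) = (k + 1) c N (N - k) - N c N (N - k - 1)\<close>. Its left-hand
  side is \<open>(k + 1) b (N + 1) (N - k)\<close>. On the right, \<open>e\<^sup>x Q = Q + x\<close> splits
  \<open>c N (N - k)\<close> into \<open>b (N + 1) (N - k) + b N (N - k - 1)\<close>, and the last summand cancels
  because \<open>N c N (N - k - 1) = (k + 1) b N (N - k - 1)\<close>.
\<close>

lemma signed_stirling_conv_nth_bern_series_power:
  assumes "j \<le> N"
  shows "fact j * of_int (signed_stirling N j) =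
           fact N * fps_nth (fps_exp 1 * bern_series ^ Suc N :: 'a :: field_char_0 fps) (N - j)"
  using assms
proof (induction N arbitrary: j)
  case 0
  thus ?case by (simp add: signed_stirling_def fps_X_over_exp_nth_0)
next
  case (Suc N)
  define Q :: "'a fps" where "Q = bern_series"
  define c where "c = (\<lambda>n i. fps_nth (fps_exp 1 * Q ^ Suc n) i)"
  define b where "b = (\<lambda>n i. fps_nth (Q ^ n) i)"
  have rec: "of_nat (Suc n) * c (Suc n) i = (of_nat (Suc n) - of_nat i) * b (Suc n) i" for n i
    using nth_exp_mult_bern_series_power [where ?'a = 'a, of n i]
    unfolding Q_def c_def b_def by simp
  show ?case
  proof (cases j)
    case 0
    \<comment> \<open>Both sides vanish, the right-hand one because of the factor \<open>n + 1 - i\<close> in \<open>rec\<close>.\<close>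
    have "of_nat (Suc N) * c (Suc N) (Suc N) = 0"
      unfolding rec by simp
    hence "c (Suc N) (Suc N) = 0"
      by (metis mult_eq_0_iff of_nat_eq_0_iff Suc_neq_Zero)
    moreover have "signed_stirling (Suc N) 0 = 0"
      by (induction N) (simp_all add: signed_stirling_Suc_0)
    ultimately show ?thesis
      using 0 by (simp add: c_def Q_def)
  next
    case j: (Suc k)
    have kN: "k \<le> N" using Suc.prems j by simp
    have IH1: "fact k * of_int (signed_stirling N k) = fact N * c N (N - k)"
      using Suc.IH [OF kN] unfolding c_def Q_def .
    have split: "c n (Suc i) = b (Suc n) (Suc i) + b n i" for n i
    proof -
      have "fps_exp 1 * Q ^ Suc n = Q ^ Suc n + fps_X * Q ^ n"
        using exp_mult_bern_series [where ?'a = 'a]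
        by (simp add: Q_def [symmetric] distrib_right flip: mult.assoc)
      thus ?thesis by (simp add: c_def b_def)
    qed
    \<comment> \<open>For \<open>k = N\<close> the term with \<open>s(N, k + 1) = 0\<close> has no counterpart \<open>c N (- 1)\<close>, hence the
      case distinction.\<close>
    have main: "of_nat (Suc k) * c N (N - k) -
          (if k < N then of_nat N * c N (N - Suc k) else 0) = of_nat (Suc k) * b (Suc N) (N - k)"
    proof (cases "k < N")
      case True
      obtain M where M: "N = Suc M" using True by (cases N) auto
      obtain i where i: "N - k = Suc i" "N = Suc (k + i)"
        using True by (metis add_Suc_right less_imp_add_positive gr0_implies_Suc diff_add_inverse)
      have "of_nat N * c N i = (of_nat N - of_nat i) * b N i"
        using rec [of M i] M by simp
      also have "of_nat N - of_nat i = (of_nat (Suc k) :: 'a)"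
        using i by simp
      finally show ?thesis
        using True i split [of N i] by (simp add: distrib_left)
    next
      case False
      hence "N - k = 0" by simp
      thus ?thesis using False
        by (simp add: c_def b_def fps_mult_nth)
    qed
    have IH2: "fact (Suc k) * (of_nat N * of_int (signed_stirling N (Suc k))) =
                 fact N * (if k < N then of_nat N * c N (N - Suc k) else 0)"
    proof (cases "k < N")
      case True
      thus ?thesis
        using Suc.IH [of "Suc k"] by (simp only: c_def Q_def if_True) (simp add: algebra_simps)
    next
      case False
      thus ?thesis by (simp add: signed_stirling_eq_0)
    qed
    have "fact j * of_int (signed_stirling (Suc N) j) =
            of_nat (Suc k) * (fact k * of_int (signed_stirling N k)) -
            fact (Suc k) * (of_nat N * of_int (signed_stirling N (Suc k)) :: 'a)"
      unfolding j signed_stirling_Suc_Suc by (simp add: algebra_simps)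
    also have "\<dots> = fact N * (of_nat (Suc k) * c N (N - k) -
          (if k < N then of_nat N * c N (N - Suc k) else 0))"
      unfolding IH1 IH2 by (simp only: algebra_simps)
    also have "\<dots> = fact N * (of_nat (Suc k) * b (Suc N) (N - k))"
      unfolding main ..
    also have "of_nat (Suc k) = (of_nat (Suc N) - of_nat (N - k) :: 'a)"
      using kN by (simp add: of_nat_diff)
    also have "(of_nat (Suc N) - of_nat (N - k)) * b (Suc N) (N - k) = of_nat (Suc N) * c (Suc N) (N - k)"
      by (rule rec [symmetric])
    finally show ?thesis
      unfolding j c_def Q_def by (simp add: algebra_simps)
  qed
qed

section \<open>Generalized Bernoulli polynomials of order \<open>N + 2\<close>\<close>

lemma gen_bernpoly_nat: "gen_bernpoly (int r) n t = fact n * fps_nth (bern_series ^ r * fps_exp t) n"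
  by (simp add: gen_bernpoly_def gen_bernpoly_fps_def)

lemma bernpoly_nth: "fps_nth (bern_series * fps_exp t) n = bernpoly n t / fact n"
  using gen_bernpoly_nat [of 1 n t] by (simp add: bernpoly_eq_gen_bernpoly)

lemma gen_bernpoly_conv_signed_stirling:
  assumes "n \<le> N"
  shows "gen_bernpoly (int N + 2) n (t + 1) = fact n / fact N *
           (\<Sum>j = N - n..N. fact j / fact (j + n - N) * real_of_int (signed_stirling N j) *
              bernpoly (j + n - N) t)"
proof -
  define Q :: "real fps" where "Q = bern_series"
  have "Q ^ (N + 2) * fps_exp (t + 1) = (Q * fps_exp t) * (fps_exp 1 * Q ^ Suc N)"
    by (simp add: fps_exp_add_mult mult_ac)
  hence "gen_bernpoly (int N + 2) n (t + 1) =
           fact n * fps_nth ((Q * fps_exp t) * (fps_exp 1 * Q ^ Suc N)) n"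
    using gen_bernpoly_nat [of "N + 2" n "t + 1"] by (simp only: Q_def of_nat_add of_nat_numeral)
  also have "fps_nth ((Q * fps_exp t) * (fps_exp 1 * Q ^ Suc N)) n =
      (\<Sum>k = 0..n. bernpoly k t / fact k * fps_nth (fps_exp 1 * Q ^ Suc N) (n - k))"
    unfolding fps_mult_nth [of "Q * fps_exp t"] by (simp add: Q_def bernpoly_nth)
  \<comment> \<open>the index of the Stirling number is \<open>j = N - (n - k)\<close>\<close>
  also have "\<dots> = (\<Sum>j = N - n..N. bernpoly (j + n - N) t / fact (j + n - N) *
                    fps_nth (fps_exp 1 * Q ^ Suc N) (N - j))"
    using assms
    by (intro sum.reindex_bij_witness [of _ "\<lambda>j. j + n - N" "\<lambda>k. k + N - n"]) (auto simp: Suc_diff_le)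
  also have "\<dots> = (\<Sum>j = N - n..N. bernpoly (j + n - N) t / fact (j + n - N) *
                    (fact j * real_of_int (signed_stirling N j) / fact N))"
    unfolding Q_def
    by (intro sum.cong refl) (subst signed_stirling_conv_nth_bern_series_power, auto)
  finally show ?thesis
    by (simp add: sum_distrib_left algebra_simps)
qed

section \<open>Reflection\<close>

lemma bern_series_compose_uminus:
  "bern_series oo - fps_X = fps_exp 1 * (bern_series :: 'a :: field_char_0 fps)"
proof -
  define Q :: "'a fps" where "Q = bern_series"
  have Q: "Q * (fps_exp 1 - 1) = fps_X"
    unfolding Q_def by (rule fps_X_over_exp_mult)
  have X0: "fps_nth (- fps_X :: 'a fps) 0 = 0" by simp
  have inv: "fps_exp 1 * fps_exp (-1) = (1 :: 'a fps)"
    by (simp flip: fps_exp_add_mult)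
  have "(Q oo - fps_X) * (fps_exp (-1) - 1) = (Q * (fps_exp 1 - 1)) oo - fps_X"
    by (simp add: fps_compose_mult_distrib [OF X0] fps_compose_sub_distrib)
  also have "\<dots> = - (Q * (fps_exp 1 - 1))"
    unfolding Q by simp
  also have "\<dots> = fps_exp 1 * Q * (fps_exp (-1) - 1)"
    using inv by algebra
  finally have "(Q oo - fps_X) * (fps_exp (-1) - 1) = fps_exp 1 * Q * (fps_exp (-1) - 1)" .
  moreover have "fps_exp (-1) - 1 \<noteq> (0 :: 'a fps)"
    using inv exp_minus_1_fps_nonzero [where ?'a = 'a] by auto
  ultimately show ?thesis
    unfolding Q_def by simp
qed

text \<open>
  Since \<open>Q(-x) = e\<^sup>x Q(x)\<close>, replacing \<open>x\<close> by \<open>-x\<close> turns \<open>Q\<^sup>r e\<^sup>t\<^sup>x\<close> into \<open>Q\<^sup>r e\<^sup>(\<^sup>r\<^sup>-\<^sup>t\<^sup>)\<^sup>x\<close>.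
\<close>

lemma gen_bernpoly_reflect:
  "gen_bernpoly (int r) n (real r - t) = (-1) ^ n * gen_bernpoly (int r) n t"
proof -
  define Q :: "real fps" where "Q = bern_series"
  have X0: "fps_nth (- fps_X :: real fps) 0 = 0" by simp
  have "(Q ^ r * fps_exp t) oo - fps_X = (fps_exp 1 * Q) ^ r * fps_exp (- t)"
    using bern_series_compose_uminus [where ?'a = real]
    by (simp add: fps_compose_mult_distrib [OF X0] fps_compose_power [OF X0, symmetric] Q_def)
  also have "\<dots> = Q ^ r * fps_exp (real r - t)"
    by (simp add: power_mult_distrib fps_exp_power_mult fps_exp_add_mult [of "real r" "-t", simplified])
  finally have "fps_nth (Q ^ r * fps_exp (real r - t)) n = (-1) ^ n * fps_nth (Q ^ r * fps_exp t) n"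
    by (metis fps_compose_uminus' fps_nth_Abs_fps)
  thus ?thesis
    by (simp add: gen_bernpoly_nat Q_def)
qed

section \<open>The two expansions at integer points\<close>

lemma pochhammer_of_nat_Suc:
  "pochhammer (of_nat k + 1) d = (fact (k + d) / fact k :: 'a :: field_char_0)"
  using pochhammer_product [of k "k + d" "1 :: 'a"] by (simp add: pochhammer_fact [symmetric] add_ac)

theorem proposition4p3:
  fixes m n :: nat
  assumes "n \<le> m"
  shows "gen_bernpoly (2 * int m + 2) (2 * n) (real m + 1) =
           fact (2 * n) / fact (2 * m) *
             (\<Sum>j = 2 * m - 2 * n..2 * m.
                1 / (real j + 1) * real_of_int (signed_stirling (2 * m) j) *
                pochhammer (real j + 2 * real n - 2 * real m + 1) (2 * m - 2 * n + 1) *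
                bernpoly (j + 2 * n - 2 * m) (real m)) \<and>
         (n < m \<longrightarrow>
          gen_bernpoly (2 * int m + 1) (2 * n) (real m) =
           fact (2 * n) / fact (2 * m - 1) *
             (\<Sum>j = 2 * m - 1 - 2 * n..2 * m - 1.
                1 / (real j + 1) * real_of_int (signed_stirling (2 * m - 1) j) *
                pochhammer (real j + 2 * real n - 2 * real m + 2) (2 * m - 2 * n) *
                bernpoly (j + 2 * n + 1 - 2 * m) (real m)))"
proof (intro conjI impI)
  let ?T = "\<lambda>N j. fact j / fact (j + 2 * n - N) * real_of_int (signed_stirling N j) *
              bernpoly (j + 2 * n - N) (real m)"
  \<comment> \<open>The summands carry \<open>(k + 1)\<^sub>d / (j + 1)\<close> with \<open>k + d = j + 1\<close>, which is \<open>j! / k!\<close>.\<close>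
  have coeff: "1 / (real j + 1) * x * pochhammer (real k + 1) d = fact j / fact k * x"
    if "j + 1 = k + d" for j k d and x :: real
  proof -
    have "pochhammer (real k + 1) d = (real j + 1) * fact j / fact k"
      using pochhammer_of_nat_Suc [where ?'a = real, of k d] that [symmetric] by simp
    thus ?thesis by simp
  qed
  show "gen_bernpoly (2 * int m + 2) (2 * n) (real m + 1) =
           fact (2 * n) / fact (2 * m) *
             (\<Sum>j = 2 * m - 2 * n..2 * m.
                1 / (real j + 1) * real_of_int (signed_stirling (2 * m) j) *
                pochhammer (real j + 2 * real n - 2 * real m + 1) (2 * m - 2 * n + 1) *
                bernpoly (j + 2 * n - 2 * m) (real m))"
  proof -
    have "1 / (real j + 1) * real_of_int (signed_stirling (2 * m) j) *
                pochhammer (real j + 2 * real n - 2 * real m + 1) (2 * m - 2 * n + 1) *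
                bernpoly (j + 2 * n - 2 * m) (real m) = ?T (2 * m) j"
      if "j \<in> {2 * m - 2 * n..2 * m}" for j
    proof -
      have "2 * m \<le> j + 2 * n"
        using that unfolding atLeastAtMost_iff by linarith
      hence "real j + 2 * real n - 2 * real m = real (j + 2 * n - 2 * m)"
        by (simp add: of_nat_diff)
      moreover have "j + 1 = (j + 2 * n - 2 * m) + (2 * m - 2 * n + 1)"
        using that assms unfolding atLeastAtMost_iff by linarith
      ultimately show ?thesis
        using coeff by metis
    qed
    thus ?thesis
      using gen_bernpoly_conv_signed_stirling [of "2 * n" "2 * m" "real m"] assms by simp
  qed
  show "gen_bernpoly (2 * int m + 1) (2 * n) (real m) =
           fact (2 * n) / fact (2 * m - 1) *
             (\<Sum>j = 2 * m - 1 - 2 * n..2 * m - 1.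
                1 / (real j + 1) * real_of_int (signed_stirling (2 * m - 1) j) *
                pochhammer (real j + 2 * real n - 2 * real m + 2) (2 * m - 2 * n) *
                bernpoly (j + 2 * n + 1 - 2 * m) (real m))"
    if "n < m"
  proof -
    have summand: "1 / (real j + 1) * real_of_int (signed_stirling (2 * m - 1) j) *
                pochhammer (real j + 2 * real n - 2 * real m + 2) (2 * m - 2 * n) *
                bernpoly (j + 2 * n + 1 - 2 * m) (real m) = ?T (2 * m - 1) j"
      if j: "j \<in> {2 * m - 1 - 2 * n..2 * m - 1}" for j
    proof -
      have idx: "j + 2 * n + 1 - 2 * m = j + 2 * n - (2 * m - 1)"
        using \<open>n < m\<close> by simp
      have "2 * m \<le> j + 2 * n + 1"
        using j unfolding atLeastAtMost_iff by linarith
      hence "real j + 2 * real n - 2 * real m + 2 = real (j + 2 * n - (2 * m - 1)) + 1"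
        unfolding idx [symmetric] by (simp add: of_nat_diff)
      moreover have "j + 1 = (j + 2 * n - (2 * m - 1)) + (2 * m - 2 * n)"
        using j \<open>n < m\<close> unfolding atLeastAtMost_iff by linarith
      ultimately show ?thesis
        unfolding idx using coeff by metis
    qed
    have reflect: "gen_bernpoly (2 * int m + 1) (2 * n) (real m) =
        gen_bernpoly (2 * int m + 1) (2 * n) (real m + 1)"
      using gen_bernpoly_reflect [of "2 * m + 1" "2 * n" "real m"] by (simp add: add_ac)
    have order: "int (2 * m - 1) + 2 = 2 * int m + 1" and le: "2 * n \<le> 2 * m - 1"
      using \<open>n < m\<close> by simp_all
    show ?thesis
      using gen_bernpoly_conv_signed_stirling [OF le, of "real m"]
      unfolding reflect order by (simp only: summand cong: sum.cong)
  qed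
qed

end
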